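(* Let $b\ge2$, $s\in\mathbb{N}$, $t\in\mathbb{N}_0$, and for each integer $m\ge t$ let $\Delta_b(t,m,s)$ be a number such that $b^mD_{b^m}(\mathcal{P})\le\Delta_b(t,m,s)$ for every $(t,m,s)$-net $\mathcal{P}$ in base $b$. Let $(\boldsymbol{x}_n)_{n\ge0}$ be a $(t,s)$-sequence in base $b$. Then for every $N\in\mathbb{N}$, $$N\widetilde{D}_N((\boldsymbol{x}_n)_{n\ge0})\le(2b-1)\left(t\,b^t+\sum_{m=t}^{\lfloor\log_bN\rfloor}\Delta_b(t,m,s)\right).$$
   Context: Discrepancy of $N$ points / a sequence in $[0,1)^s$: $D_N:=\sup_{[\boldsymbol{a},\boldsymbol{b})\subseteq[0,1)^s}|\#\{0\le n<N:\boldsymbol{y}_n\in[\boldsymbol{a},\boldsymbol{b})\}/N-\mathrm{vol}([\boldsymbol{a},\boldsymbol{b}))|$. Uniform discrepancy: $\widetilde{D}_N((\boldsymbol{x}_n)):=\sup_{k\in\mathbb{N}_0}D_N((\boldsymbol{x}_{n+k})_{n\ge0})$. An elementary interval in base $b$ is $\prod_{i=1}^s[a_ib^{-d_i},(a_i+1)b^{-d_i})$ with integers $d_i\ge0$, $0\le a_i<b^{d_i}$. For $0\le t\le m$, a $(t,m,s)$-net in base $b$ is a set of $b^m$ points in $[0,1)^s$ such that every elementary interval of volume $b^{t-m}$ contains exactly $b^t$ of them. A $(t,s)$-sequence in base $b$ is a sequence such that for all $k\ge0$, $m\ge t$, the points with indices $kb^m\le n<(k+1)b^m$ form a $(t,m,s)$-net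 in base $b$. *)

theory Defs
  imports "HOL-Analysis.Analysis"
begin

(* The library's atLeastLessThan does not denote this set on vectors: there the strict order is
   "componentwise less or equal, and not equal". *)
definition half_open_box :: "real ^ 's \<Rightarrow> real ^ 's \<Rightarrow> (real ^ 's) set" where
  "half_open_box u v = {x. \<forall>i. u $ i \<le> x $ i \<and> x $ i < v $ i}"

definition unit_cube :: "(real ^ 's) set" where
  "unit_cube = half_open_box (\<chi> i. 0) (\<chi> i. 1)"

(* Only the points y 0, ..., y (N - 1) matter, and they are counted with multiplicity.
   For N > 0 the supremum is over a nonempty set of reals in [0,1]. *)
definition discrepancy :: "nat \<Rightarrow> (nat \<Rightarrow> real ^ 's) \<Rightarrow> real" where
  "discrepancy N y =
     (SUP J \<in> {half_open_box u v | u v. half_open_box u v \<subseteq> unit_cube}.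
        \<bar>real (card {n. n < N \<and> y n \<in> J}) / real N - measure lborel J\<bar>)"

definition uniform_discrepancy :: "nat \<Rightarrow> (nat \<Rightarrow> real ^ 's) \<Rightarrow> real" where
  "uniform_discrepancy N x = (SUP k. discrepancy N (\<lambda>n. x (n + k)))"

definition elementary_interval :: "nat \<Rightarrow> (real ^ 's) set \<Rightarrow> bool" where
  "elementary_interval b E \<longleftrightarrow>
     (\<exists>(a :: 's \<Rightarrow> nat) (d :: 's \<Rightarrow> nat). (\<forall>i. a i < b ^ d i) \<and>
        E = half_open_box (\<chi> i. real (a i) / real b ^ d i) (\<chi> i. (real (a i) + 1) / real b ^ d i))"

(* The b^m points of a net form a finite family P 0, ..., P (b^m - 1), so that repeated points
   count with multiplicity; the values of P at larger indices are irrelevant. *)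
definition tms_net :: "nat \<Rightarrow> nat \<Rightarrow> nat \<Rightarrow> (nat \<Rightarrow> real ^ 's) \<Rightarrow> bool" where
  "tms_net b t m P \<longleftrightarrow>
     t \<le> m \<and> (\<forall>n < b ^ m. P n \<in> unit_cube) \<and>
     (\<forall>E. elementary_interval b E \<and> measure lborel E = real b powi (int t - int m) \<longrightarrow>
        card {n. n < b ^ m \<and> P n \<in> E} = b ^ t)"

definition ts_sequence :: "nat \<Rightarrow> nat \<Rightarrow> (nat \<Rightarrow> real ^ 's) \<Rightarrow> bool" where
  "ts_sequence b t x \<longleftrightarrow>
     (\<forall>n. x n \<in> unit_cube) \<and>
     (\<forall>k. \<forall>m \<ge> t. tms_net b t m (\<lambda>n. x (k * b ^ m + n)))"

end

theory Submission
  imports Defs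
begin

text \<open>
  Fix a box \<open>J\<close> and let \<open>F n\<close> be the local discrepancy of the first \<open>n\<close> points, so that a window
  \<open>[k, k + N)\<close> contributes \<open>F (k + N) - F k\<close>. With \<open>b ^ M \<le> N < b ^ (M + 1)\<close>, the window
  contains at most \<open>b - 1\<close> consecutive aligned blocks of length \<open>b ^ M\<close>; the two remaining ends are
  shorter than \<open>b ^ M\<close>, and each is exhausted greedily by at most \<open>b - 1\<close> aligned blocks at every
  level \<open>m = M - 1, \<dots>, t\<close>. Every aligned block is a net and costs at most \<open>\<Delta> m\<close>, and fewer than
  \<open>b ^ t\<close> points are left over at either end.
\<close>

section \<open>Local discrepancy of a box and its relation to \<open>discrepancy\<close>\<close>

lemma half_open_box_borel [measurable]: "half_open_box u v \<in> sets borel"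
  unfolding half_open_box_def by measurable

lemma measure_le_one_of_subset_unit_cube:
  fixes u v :: "real ^ 's"
  assumes "half_open_box u v \<subseteq> unit_cube"
  shows "measure lborel (half_open_box u v) \<le> 1"
proof -
  have "half_open_box u v \<subseteq> cbox 0 (1 :: real ^ 's)"
    using assms by (auto simp: unit_cube_def half_open_box_def mem_box_cart subset_iff intro: less_imp_le)
  then have "measure lborel (half_open_box u v) \<le> measure lborel (cbox 0 (1 :: real ^ 's))"
    by (intro measure_mono_fmeasurable fmeasurable_cbox) auto
  also have "\<dots> = 1"
    by (simp add: content_cbox_if_cart interval_eq_empty_cart)
  finally show ?thesis .
qed

text \<open>The contribution of one point to the unnormalised local discrepancy (count minus number
  of points times volume). It is additive in the points, so windows of a sequence become differences
  of partial sums.\<close>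

definition local_term :: "(real ^ 's) set \<Rightarrow> real ^ 's \<Rightarrow> real" where
  "local_term J p = indicator J p - measure lborel J"

lemma abs_local_term_le_one:
  assumes "half_open_box u v \<subseteq> unit_cube"
  shows "\<bar>local_term (half_open_box u v) p\<bar> \<le> 1"
  using measure_le_one_of_subset_unit_cube[OF assms]
  by (auto simp: local_term_def indicator_def abs_le_iff intro: order_trans[of _ 0])

lemma sum_local_term:
  assumes "N > 0"
  shows "\<bar>\<Sum>n<N. local_term J (y n)\<bar> =
    real N * \<bar>real (card {n. n < N \<and> y n \<in> J}) / real N - measure lborel J\<bar>"
proof -
  have "(\<Sum>n<N. indicator J (y n) :: real) = real (card {n. n < N \<and> y n \<in> J})"
    by (simp add: indicator_def sum.If_cases Collect_conj_eq lessThan_def Int_commute)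
  then have "(\<Sum>n<N. local_term J (y n)) =
      real N * (real (card {n. n < N \<and> y n \<in> J}) / real N - measure lborel J)"
    using assms by (simp add: local_term_def sum_subtractf field_simps)
  then show ?thesis
    by (simp add: abs_mult)
qed

text \<open>A single box can be compared with the real supremum only once the family is known to be
  bounded above; the bound 1 comes from \<open>abs_local_term_le_one\<close>, averaged over the
  \<open>N\<close> points.\<close>

lemma abs_sum_local_term_le_discrepancy:
  assumes "N > 0" and J: "half_open_box u v \<subseteq> unit_cube"
  shows "\<bar>\<Sum>n<N. local_term (half_open_box u v) (y n)\<bar> \<le> real N * discrepancy N y"
proof -
  let ?g = "\<lambda>J. \<bar>real (card {n. n < N \<and> y n \<in> J}) / real N - measure lborel J\<bar>"
  let ?B = "{half_open_box u v | u v. half_open_box u v \<subseteq> (unit_cube :: (real ^ 's) set)}"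
  have "?g J \<le> 1" if "J \<in> ?B" for J
  proof -
    from that have "\<bar>local_term J (y n)\<bar> \<le> 1" for n
      using abs_local_term_le_one by blast
    then have "\<bar>\<Sum>n<N. local_term J (y n)\<bar> \<le> real N * 1"
      by (intro order_trans[OF sum_abs] order_trans[OF sum_bounded_above[where K = 1]]) auto
    then show ?thesis
      unfolding sum_local_term[OF \<open>N > 0\<close>] using \<open>N > 0\<close> by (simp only: mult_le_cancel_left_pos of_nat_0_less_iff)
  qed
  then have "bdd_above (?g ` ?B)"
    by (intro bdd_aboveI2)
  then have "?g (half_open_box u v) \<le> discrepancy N y"
    unfolding discrepancy_def using J by (intro cSUP_upper) auto
  then show ?thesis
    unfolding sum_local_term[OF \<open>N > 0\<close>] by (intro mult_left_mono) auto
qed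

lemma half_open_box_same: "half_open_box u u = {}"
  by (auto simp: half_open_box_def intro: leD)

text \<open>The degenerate box from 0 to 0 is empty, so its local discrepancy is 0, and the supremum
  dominates it.\<close>

lemma discrepancy_nonneg:
  fixes y :: "nat \<Rightarrow> real ^ 's"
  assumes "N > 0"
  shows "0 \<le> real N * discrepancy N y"
  using abs_sum_local_term_le_discrepancy[OF assms, of 0 0 y]
  by (simp add: half_open_box_same local_term_def)

lemma discrepancy_leI:
  fixes y :: "nat \<Rightarrow> real ^ 's"
  assumes "N > 0"
    and "\<And>u v. half_open_box u v \<subseteq> unit_cube \<Longrightarrow>
      \<bar>\<Sum>n<N. local_term (half_open_box u v) (y n)\<bar> \<le> B"
  shows "discrepancy N y \<le> B / real N"
  unfolding discrepancy_def
proof (rule cSUP_least)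
  \<comment> \<open>The empty box also shows that the supremum runs over a nonempty family.\<close>
  have "half_open_box (0 :: real ^ 's) 0 \<subseteq> unit_cube"
    by (simp add: half_open_box_same)
  then show "{half_open_box u v | u v. half_open_box u v \<subseteq> (unit_cube :: (real ^ 's) set)} \<noteq> {}"
    by blast
next
  fix J :: "(real ^ 's) set"
  assume "J \<in> {half_open_box u v | u v. half_open_box u v \<subseteq> unit_cube}"
  then have "\<bar>\<Sum>n<N. local_term J (y n)\<bar> \<le> B"
    using assms(2) by blast
  then show "\<bar>real (card {n. n < N \<and> y n \<in> J}) / real N - measure lborel J\<bar> \<le> B / real N"
    unfolding sum_local_term[OF \<open>N > 0\<close>] using \<open>N > 0\<close> by (simp only: pos_le_divide_eq of_nat_0_less_iff mult.commute)
qed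

section \<open>Exhausting intervals of indices by aligned blocks\<close>

text \<open>Triangle inequality along the steps between \<open>q\<close> and \<open>p\<close>, in
  either order. It serves for single points, with \<open>D = 1\<close>, and for whole blocks, with
  \<open>G k = F (k * b ^ m)\<close>.\<close>

lemma abs_diff_le_of_steps:
  fixes G :: "nat \<Rightarrow> real"
  assumes "\<And>k. \<bar>G (Suc k) - G k\<bar> \<le> D"
  shows "\<bar>G p - G q\<bar> \<le> real_of_int \<bar>int p - int q\<bar> * D"
proof -
  have *: "\<bar>G (q + d) - G q\<bar> \<le> real d * D" for q d
  proof (induction d)
    case (Suc d)
    then show ?case
      using assms[of "q + d"] by (simp add: algebra_simps)
  qed simp
  show ?thesis
  proof (cases "q \<le> p")
    case True
    then show ?thesis
      using *[of q "p - q"] by (simp add: of_nat_diff)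
  next
    case False
    then show ?thesis
      using *[of p "q - p"] by (simp add: of_nat_diff abs_minus_commute)
  qed
qed

text \<open>Round \<open>u\<close> to a multiple of \<open>c\<close> in the direction of the anchor
  \<open>q * (b * c)\<close>. With \<open>r\<close> the distance to the anchor, the new multiple is
  \<open>r div c\<close> blocks away from it, at most \<open>b - 1\<close> because
  \<open>r < b * c\<close>; rounding away from the anchor could cost \<open>b\<close>
  blocks.\<close>

lemma nearest_multiple_towards:
  fixes b c q u :: nat
  assumes "c > 0" and u: "\<bar>int u - int (q * (b * c))\<bar> < int (b * c)"
  obtains p where "\<bar>int u - int (p * c)\<bar> < int c" and "\<bar>int p - int (q * b)\<bar> \<le> int b - 1"
proof (cases "q * (b * c) \<le> u")
  case True
  define r where "r = u - q * (b * c)"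
  have r: "r < b * c" "u = q * (b * c) + r"
    using True u unfolding r_def by linarith+
  have "r div c < b"
    using r(1) by (simp add: less_mult_imp_div_less)
  moreover have "u = (q * b + r div c) * c + r mod c"
    by (simp add: r(2) algebra_simps)
  then have "\<bar>int u - int ((q * b + r div c) * c)\<bar> < int c"
    using \<open>c > 0\<close> by simp
  ultimately show ?thesis
    by (intro that[of "q * b + r div c"]) auto
next
  case False
  define r where "r = q * (b * c) - u"
  have r: "r < b * c" "u + r = q * (b * c)"
    using False u unfolding r_def by linarith+
  have lt: "r div c < b"
    using r(1) by (simp add: less_mult_imp_div_less)
  \<comment> \<open>As \<open>u\<close> lies below the anchor, \<open>q\<close> is positive; hence
    \<open>r div c < b \<le> q * b\<close>, and the natural subtraction in the witness is not
    truncated.\<close>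
  have "q \<ge> 1"
    using False by (cases q) auto
  then have le: "r div c \<le> q * b"
    using lt by (metis less_imp_le_nat mult_le_mono1 nat_mult_1 order_trans)
  have "u + r mod c + (r div c) * c = (q * b) * c"
    using r(2) by (simp add: algebra_simps)
  then have "u + r mod c = (q * b - r div c) * c"
    unfolding diff_mult_distrib by linarith
  then have "\<bar>int u - int ((q * b - r div c) * c)\<bar> < int c"
    using \<open>c > 0\<close> by (metis abs_minus_commute add_diff_cancel_left' abs_of_nat mod_less_divisor of_nat_add of_nat_less_iff)
  then show ?thesis
    using lt le by (intro that[of "q * b - r div c"]) auto
qed

text \<open>Induction on the level, with \<open>q\<close> arbitrary because each step replaces the
  anchor \<open>q * b ^ Suc m\<close> by a closer one, \<open>p * b ^ m\<close>. The distance is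
  two-sided so that the lemma covers both ends of a window.\<close>

lemma abs_diff_le_near_multiple:
  fixes F :: "nat \<Rightarrow> real" and \<Delta> :: "nat \<Rightarrow> real"
  assumes "b > 0"
    and step: "\<And>n. \<bar>F (Suc n) - F n\<bar> \<le> 1"
    and block: "\<And>m k. m \<ge> t \<Longrightarrow> \<bar>F (Suc k * b ^ m) - F (k * b ^ m)\<bar> \<le> \<Delta> m"
    and "m \<ge> t" and "\<bar>int u - int (q * b ^ m)\<bar> < int (b ^ m)"
  shows "\<bar>F u - F (q * b ^ m)\<bar> \<le> (real b ^ t - 1) + (real b - 1) * (\<Sum>j = t..<m. \<Delta> j)"
  using \<open>m \<ge> t\<close> assms(5)
proof (induction m arbitrary: q rule: dec_induct)
  case base
  have "\<bar>F u - F (q * b ^ t)\<bar> \<le> real_of_int \<bar>int u - int (q * b ^ t)\<bar> * 1"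
    using step by (rule abs_diff_le_of_steps)
  \<comment> \<open>Integer distances turn the strict inequality into the gain of 1.\<close>
  also have "\<bar>int u - int (q * b ^ t)\<bar> \<le> int (b ^ t) - 1"
    using base by simp
  then have "real_of_int \<bar>int u - int (q * b ^ t)\<bar> * 1 \<le> real_of_int (int (b ^ t) - 1)"
    by (simp only: mult_1_right of_int_le_iff)
  finally show ?case
    by simp
next
  case (step m)
  from step.prems have "\<bar>int u - int (q * (b * b ^ m))\<bar> < int (b * b ^ m)"
    by simp
  then obtain p where p: "\<bar>int u - int (p * b ^ m)\<bar> < int (b ^ m)" "\<bar>int p - int (q * b)\<bar> \<le> int b - 1"
    using nearest_multiple_towards[of "b ^ m"] \<open>b > 0\<close> by (metis zero_less_power)
  have D: "0 \<le> \<Delta> m"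
    using block[OF step.hyps(1), of 0] by linarith
  have "\<bar>F (p * b ^ m) - F ((q * b) * b ^ m)\<bar> \<le> real_of_int \<bar>int p - int (q * b)\<bar> * \<Delta> m"
    using abs_diff_le_of_steps[of "\<lambda>k. F (k * b ^ m)", OF block[OF step.hyps(1)]] .
  also have "\<dots> \<le> real_of_int (int b - 1) * \<Delta> m"
    using p(2) D by (intro mult_right_mono) (simp_all only: of_int_le_iff)
  finally have "\<bar>F (p * b ^ m) - F (q * b ^ Suc m)\<bar> \<le> (real b - 1) * \<Delta> m"
    by (simp add: mult.assoc)
  moreover have "\<bar>F u - F (p * b ^ m)\<bar> \<le> (real b ^ t - 1) + (real b - 1) * (\<Sum>j = t..<m. \<Delta> j)"
    using step.IH p(1) .
  ultimately show ?case
    using step.hyps by (simp add: distrib_left)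
qed

lemma window_bound:
  fixes F :: "nat \<Rightarrow> real" and \<Delta> :: "nat \<Rightarrow> real"
  assumes "b > 0"
    and step: "\<And>n. \<bar>F (Suc n) - F n\<bar> \<le> 1"
    and block: "\<And>m k. m \<ge> t \<Longrightarrow> \<bar>F (Suc k * b ^ m) - F (k * b ^ m)\<bar> \<le> \<Delta> m"
    and "M \<ge> t" and N: "b ^ M \<le> N" "N < b ^ Suc M"
  shows "\<bar>F (k + N) - F k\<bar> \<le> 2 * (real b ^ t - 1) + 2 * (real b - 1) * (\<Sum>m = t..M. \<Delta> m)"
proof -
  define c where "c = b ^ M"
  have c: "c > 0" "c \<le> N" "N < b * c"
    using \<open>b > 0\<close> N by (auto simp: c_def)
  \<comment> \<open>\<open>p * c\<close> and \<open>q * c\<close> are the first and last multiples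
    of \<open>c\<close> in the window: \<open>p\<close> rounds \<open>k / c\<close> up,
    \<open>q\<close> rounds \<open>(k + N) / c\<close> down.\<close>
  define p where "p = (k + c - 1) div c"
  define q where "q = (k + N) div c"
  have "p * c + (k + c - 1) mod c = k + c - 1" "(k + c - 1) mod c < c"
    using \<open>c > 0\<close> by (simp_all add: p_def)
  then have pc: "k \<le> p * c" "p * c < k + c"
    using \<open>c > 0\<close> by linarith+
  have "q * c + (k + N) mod c = k + N" "(k + N) mod c < c"
    using \<open>c > 0\<close> by (simp_all add: q_def)
  then have qc: "q * c \<le> k + N" "k + N < q * c + c"
    by linarith+
  \<comment> \<open>Since \<open>c \<le> N\<close>, we have
    \<open>p * c < k + c \<le> k + N < (q + 1) * c\<close>.\<close>
  have "p * c < (q + 1) * c"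
    using pc qc c by simp
  then have "p < q + 1"
    by (simp only: mult_less_cancel2)
  then have "p \<le> q"
    by simp
  \<comment> \<open>Since \<open>N < b * c\<close>, we have
    \<open>q * c \<le> k + N < p * c + b * c\<close>, so at most \<open>b - 1\<close> full blocks
    lie in between.\<close>
  have "q * c < (p + b) * c"
    using pc qc c by (simp add: distrib_right)
  then have "q < p + b"
    by (simp only: mult_less_cancel2)
  have D: "0 \<le> \<Delta> M"
    using block[OF \<open>M \<ge> t\<close>, of 0] by linarith
  have "\<bar>F (q * c) - F (p * c)\<bar> \<le> real_of_int \<bar>int q - int p\<bar> * \<Delta> M"
    using abs_diff_le_of_steps[of "\<lambda>k. F (k * c)" "\<Delta> M"] block[OF \<open>M \<ge> t\<close>] by (simp add: c_def)
  also have "\<dots> \<le> real_of_int (int b - 1) * \<Delta> M"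
    using \<open>p \<le> q\<close> \<open>q < p + b\<close> D by (intro mult_right_mono) linarith+
  finally have mid: "\<bar>F (q * c) - F (p * c)\<bar> \<le> (real b - 1) * \<Delta> M"
    by simp
  define E where "E = (real b ^ t - 1) + (real b - 1) * (\<Sum>m = t..<M. \<Delta> m)"
  have near: "\<bar>F u - F (l * c)\<bar> \<le> E" if "\<bar>int u - int (l * c)\<bar> < int c" for u l
    using \<open>b > 0\<close> \<open>M \<ge> t\<close> that unfolding c_def E_def
    by (intro abs_diff_le_near_multiple step block)
  have "\<bar>F k - F (p * c)\<bar> \<le> E"
    using pc by (intro near) linarith
  moreover have "\<bar>F (k + N) - F (q * c)\<bar> \<le> E"
    using qc by (intro near) linarith
  ultimately have "\<bar>F (k + N) - F k\<bar> \<le> 2 * E + (real b - 1) * \<Delta> M"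
    using mid by linarith
  \<comment> \<open>The middle blocks occur once, the two ends twice; doubling the middle lets
    \<open>\<Delta> M\<close> join the sum under one common factor.\<close>
  also have "\<dots> \<le> 2 * E + 2 * ((real b - 1) * \<Delta> M)"
    using D \<open>b > 0\<close> by simp
  also have "\<dots> = 2 * (real b ^ t - 1) + 2 * (real b - 1) * (\<Sum>m = t..M. \<Delta> m)"
    using \<open>M \<ge> t\<close> by (simp add: E_def algebra_simps flip: atLeastLessThanSuc_atLeastAtMost)
  finally show ?thesis .
qed

section \<open>The bound for every box and every window of a (t,s)-sequence\<close>

theorem theorem5:
  fixes b t :: nat
    and \<Delta> :: "nat \<Rightarrow> real"
    and x :: "nat \<Rightarrow> real ^ 's"
  assumes "b \<ge> 2"
    and "\<And>m (P :: nat \<Rightarrow> real ^ 's). m \<ge> t \<Longrightarrow> tms_net b t m P \<Longrightarrow>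
           real (b ^ m) * discrepancy (b ^ m) P \<le> \<Delta> m"
    and "ts_sequence b t x"
  shows "\<forall>N \<ge> 1. real N * uniform_discrepancy N x \<le>
           (2 * real b - 1) *
             (real t * real b ^ t + (\<Sum>m = t..nat \<lfloor>log (real b) (real N)\<rfloor>. \<Delta> m))"
proof (intro allI impI)
  fix N :: nat
  assume "N \<ge> 1"
  define M where "M = nat \<lfloor>log (real b) (real N)\<rfloor>"
  let ?B = "(2 * real b - 1) * (real t * real b ^ t + (\<Sum>m = t..M. \<Delta> m))"
  have "b > 0"
    using assms(1) by simp
  \<comment> \<open>As \<open>N \<ge> 1\<close>, the logarithm is nonnegative and \<open>nat\<close>
    truncates nothing.\<close>
  have N: "b ^ M \<le> N" "N < b ^ Suc M"
    using floor_log_nat_eq_powr_iff[of b N M] assms(1) \<open>N \<ge> 1\<close>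
    by (auto simp: M_def)
  have net: "real (b ^ m) * discrepancy (b ^ m) (\<lambda>n. x (k * b ^ m + n)) \<le> \<Delta> m" if "m \<ge> t" for m k
    using assms(2,3) that unfolding ts_sequence_def by blast
  \<comment> \<open>The blocks of \<open>x\<close> are themselves nets, so \<open>\<Delta> m\<close>
    dominates a nonnegative quantity.\<close>
  have D: "\<Delta> m \<ge> 0" if "m \<ge> t" for m
    using net[OF that] discrepancy_nonneg[of "b ^ m"] \<open>b > 0\<close> by (meson order_trans zero_less_power)
  then have sum_nonneg: "0 \<le> (\<Sum>m = t..M. \<Delta> m)"
    by (intro sum_nonneg) auto
  have "\<bar>\<Sum>n<N. local_term (half_open_box u v) (x (n + k))\<bar> \<le> ?B"
    if J: "half_open_box u v \<subseteq> unit_cube" for u v k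
  proof -
    define F where "F n = (\<Sum>i<n. local_term (half_open_box u v) (x i))" for n
    have F_diff: "F (k + n) - F k = (\<Sum>i<n. local_term (half_open_box u v) (x (k + i)))" for k n
      by (induction n) (auto simp: F_def)
    have step: "\<bar>F (Suc n) - F n\<bar> \<le> 1" for n
      using abs_local_term_le_one[OF J] by (simp add: F_def)
    have block: "\<bar>F (Suc k * b ^ m) - F (k * b ^ m)\<bar> \<le> \<Delta> m" if "m \<ge> t" for m k
      using abs_sum_local_term_le_discrepancy[OF _ J, of "b ^ m" "\<lambda>n. x (k * b ^ m + n)"] net[OF that, of k]
        F_diff[of "k * b ^ m" "b ^ m"] \<open>b > 0\<close>
      by (simp add: add.commute)
    have "\<bar>F (k + N) - F k\<bar> \<le> ?B"
    proof (cases "t \<le> M")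
      case True
      \<comment> \<open>For \<open>t = 0\<close> both sides vanish; otherwise
        \<open>2 \<le> 2 * b - 1\<close> and \<open>1 \<le> t\<close> absorb the leftover
        points.\<close>
      have "2 * (real b ^ t - 1) \<le> (2 * real b - 1) * (real t * real b ^ t)"
      proof (cases "t = 0")
        case False
        have "2 * (real b ^ t - 1) \<le> 2 * (1 * real b ^ t)"
          by simp
        also have "\<dots> \<le> (2 * real b - 1) * (1 * real b ^ t)"
          using assms(1) by (intro mult_right_mono) auto
        also have "\<dots> \<le> (2 * real b - 1) * (real t * real b ^ t)"
          using False assms(1) by (intro mult_left_mono mult_right_mono) auto
        finally show ?thesis .
      qed simp
      moreover have "2 * (real b - 1) * (\<Sum>m = t..M. \<Delta> m) \<le> (2 * real b - 1) * (\<Sum>m = t..M. \<Delta> m)"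
        using sum_nonneg by (intro mult_right_mono) auto
      moreover have "\<bar>F (k + N) - F k\<bar> \<le>
          2 * (real b ^ t - 1) + 2 * (real b - 1) * (\<Sum>m = t..M. \<Delta> m)"
        using \<open>b > 0\<close> True N by (intro window_bound step block)
      ultimately show ?thesis
        unfolding distrib_left by linarith
    next
      case False
      \<comment> \<open>Here \<open>M < t\<close>: the sum over \<open>m\<close> is empty, and the
        trivial bound of 1 per point suffices because \<open>t \<ge> 1\<close>.\<close>
      then have "N \<le> b ^ t"
        using N(2) power_increasing[of "Suc M" t b] \<open>b > 0\<close> by linarith
      have "\<bar>F (k + N) - F k\<bar> \<le> real N"
        using abs_diff_le_of_steps[of F 1 "k + N" k] step by simp
      also have "\<dots> \<le> 1 * (1 * real b ^ t)"
        using \<open>N \<le> b ^ t\<close> by (simp flip: of_nat_power)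
      also have "\<dots> \<le> (2 * real b - 1) * (real t * real b ^ t)"
        using False assms(1) by (intro mult_mono) auto
      finally show ?thesis
        using False by simp
    qed
    then show ?thesis
      using F_diff[of k N] by (simp add: add.commute)
  qed
  \<comment> \<open>The bound depends neither on the box nor on \<open>k\<close>, so it passes
    through both suprema.\<close>
  then have "discrepancy N (\<lambda>n. x (n + k)) \<le> ?B / real N" for k
    using \<open>N \<ge> 1\<close> by (intro discrepancy_leI) auto
  then have "uniform_discrepancy N x \<le> ?B / real N"
    unfolding uniform_discrepancy_def by (intro cSUP_least) auto
  then have "real N * uniform_discrepancy N x \<le> ?B"
    using \<open>N \<ge> 1\<close> by (simp add: field_simps)
  then show "real N * uniform_discrepancy N x \<le>
      (2 * real b - 1) *
        (real t * real b ^ t + (\<Sum>m = t..nat \<lfloor>log (real b) (real N)\<rfloor>. \<Delta> m))"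
    by (simp only: M_def)
qed

end
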